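(* Let $s\ge2$, $2\le w<r<\overline{n}$, $\overline{k}=\overline{n}-r$, $\overline{d}=\overline{k}+w-1$, $N=w^{\overline{n}}$, $n=s\overline{n}$, $k=n-r$, and let $c$ be a primitive element of $\mathbf{F}_q$, $q>\overline{n}$. Let $x_i\in\mathbf{F}_q\setminus\{0\}$ for $i\in[0:n)$, and let $\mathcal{C}_3$ be the $(n,k)$ array code over $\mathbf{F}_q$ with sub-packetization level $N$ and parity-check matrix $(A_i^t)_{t\in[0:r),i\in[0:n)}$, where, with $\bar i=i\%\overline{n}$, $$A_i=x_i\sum_{a=0}^{N-1}\lambda_{\bar i,a_{\bar i}}e_a^\top e_{a(\bar i,\,a_{\bar i}\oplus_w1)},\qquad \lambda_{\bar i,0}=c^{\bar i+1},\quad \lambda_{\bar i,u}=1\ \text{ for }u\in[1:w).$$ Then $\mathcal{C}_3$ is an $(n=s\overline{n},k)$ MDS array code over $\mathbf{F}_q$ with the $(d=n-\overline{n}+\overline{d},\,d_c=s-1)$-repair property and $\bigl(1+\frac{d_c(d-k)}{d}\bigr)$-optimal repair bandwidth (with the repair matrices $R_{i,j}$ given in the context) if for any given $u\in[0:s)$ and $i\in[0:\overline{n})$ the following conditions are satisfied: i) for $v_0,v_1\in[0:s)$ and $j_0,j_1\in[0:\overline{n}-1)$ with $(v_0,j_0)\ne(v_1,j_1)$, $$\begin{cases}x_{v_0\overline{n}+j_0}^wc^{j_0}\ne x_{v_1\overline{n}+j_1}^wc^{j_1},&\text{if }j_0,j_1\in[0:i)\ \text{or}\ j_0,j_1\in[i:\overline{n}-1),\\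 x_{v_0\overline{n}+j_0}^wc^{j_0}\ne x_{v_1\overline{n}+j_1}^wc^{j_1+1},&\text{if }j_0\in[0:i),\ j_1\in[i:\overline{n}-1);\end{cases}$$ ii) for $v\in[0:s)$, $x_{v\overline{n}+j}^wc^j-x_{u\overline{n}+i}^wc^i\ne0$ if $j\in[0:i)$, and $x_{v\overline{n}+j+1}^wc^{j+1}-x_{u\overline{n}+i}^wc^i\ne0$ if $j\in[i:\overline{n}-1)$.
   Context: Notation: $[a:b)=\{a,\dots,b-1\}$; $\%$ is the modulo operation; $\oplus_w$ is addition modulo $w$; $A^0=I$. $e_0,\dots,e_{N-1}$ are the standard basis row vectors of $\mathbf{F}_q^N$. For $a\in[0:N)$, $(a_0,\dots,a_{\overline{n}-1})$ is its $w$-ary expansion with $a_0$ most significant, and $a(i,u)$ is obtained from $a$ by replacing the digit $a_i$ by $u$. For $i\in[0:\overline{n})$, $V_{i,0}$ is the $w^{\overline{n}-1}\times w^{\overline{n}}$ matrix whose rows are the $e_a$ with $a_i=0$, in ascending order of $a$. Array codes: an $(n,k)$ array code with parity-check matrix $(A_{t,i})_{t\in[0:r),i\in[0:n)}$ ($r=n-k$, $A_{t,i}\in\mathbf{F}_q^{N\times N}$) is the set of $(\mathbf{f}_0,\dots,\mathbf{f}_{n-1})$, $\mathbf{f}_i\in\mathbf{F}_q^N$ columns, with $\sum_iA_{t,i}\mathbf{f}_i=0$ for all $t\in[0:r)$. It is MDS if every $r\times r$ sub-block matrix $(A_{t,i_j})_{t,j\in[0:r)}$, $i_0<\dots<i_{r-1}$,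 is non-singular (any $k$ nodes determine the codeword). Repair matrices of $\mathcal{C}_3$: for $j\ne i$, $R_{i,j}=I_N$ if $j\equiv i\bmod\overline{n}$, and $R_{i,j}=V_{\bar i,0}$ otherwise. $(d,d_c)$-repair property with $(1+\epsilon)$-optimal repair bandwidth: for every node $i$ and every $d$-subset $H_i\subseteq[0:n)\setminus\{i\}$ containing the $d_c=s-1$ compulsory helper nodes $\{j\ne i:j\equiv i\bmod\overline{n}\}$, $\mathbf{f}_i$ can be recovered from the data $R_{i,j}\mathbf{f}_j$, $j\in H_i$, and $\gamma_i=\sum_{j\in H_i}\operatorname{rank}(R_{i,j})\le(1+\epsilon)\frac{d}{d-k+1}N$.
   Formalization: In condition i), x_{v n̄+j} is read as x_{v n̄+j+1} whenever j∈[i:n̄−1) (powers of c unchanged), matching the shift in ii); as printed, i) allows x_{n̄−1}=x_{2n̄−1}, so two equal A_i and a non-MDS code. *)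

theory Defs
  imports
    Complex_Main
    "HOL-Library.FuncSet"
    "HOL-Library.Cardinality"
    "Jordan_Normal_Form.Determinant"
    "Jordan_Normal_Form.DL_Rank"
begin

definition primitive_element :: "'a::{field,finite} \<Rightarrow> bool" where
  "primitive_element c \<longleftrightarrow> range (\<lambda>m::nat. c ^ m) = UNIV - {0}"

text \<open>
  A parity-check matrix is a family \<open>A t i\<close> of \<open>N \<times> N\<close> blocks, \<open>t < r\<close>, \<open>i < n\<close>.
  Codewords \<open>(f 0, \<dots>, f (n - 1))\<close> are functions, made unique by being \<open>undefined\<close> outside \<open>{..<n}\<close>.
\<close>

definition array_code ::
  "nat \<Rightarrow> nat \<Rightarrow> nat \<Rightarrow> (nat \<Rightarrow> nat \<Rightarrow> 'a::field mat) \<Rightarrow> (nat \<Rightarrow> 'a vec) set" where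
  "array_code n k N A =
    {f \<in> {..<n} \<rightarrow>\<^sub>E carrier_vec N.
       \<forall>t<n - k. finsum_vec TYPE('a) N (\<lambda>i. A t i *\<^sub>v f i) {..<n} = 0\<^sub>v N}"

definition sub_block_mat ::
  "nat \<Rightarrow> nat \<Rightarrow> (nat \<Rightarrow> nat \<Rightarrow> 'a mat) \<Rightarrow> (nat \<Rightarrow> nat) \<Rightarrow> 'a mat" where
  "sub_block_mat r N A J =
    mat (r * N) (r * N) (\<lambda>(p, l). A (p div N) (J (l div N)) $$ (p mod N, l mod N))"

definition is_MDS :: "nat \<Rightarrow> nat \<Rightarrow> nat \<Rightarrow> (nat \<Rightarrow> nat \<Rightarrow> 'a::field mat) \<Rightarrow> bool" where
  "is_MDS n k N A \<longleftrightarrow>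
    (\<forall>J. strict_mono_on {..<n - k} J \<and> J ` {..<n - k} \<subseteq> {..<n} \<longrightarrow>
       det (sub_block_mat (n - k) N A J) \<noteq> 0)"

definition recoverable ::
  "(nat \<Rightarrow> 'a::field vec) set \<Rightarrow> (nat \<Rightarrow> nat \<Rightarrow> 'a mat) \<Rightarrow> nat \<Rightarrow> nat set \<Rightarrow> bool" where
  "recoverable C R i H \<longleftrightarrow>
    (\<exists>\<phi> :: (nat \<Rightarrow> 'a vec) \<Rightarrow> 'a vec. \<forall>f\<in>C. f i = \<phi> (\<lambda>j\<in>H. R i j *\<^sub>v f j))"

abbreviation mat_rank :: "'a::field mat \<Rightarrow> nat" where
  "mat_rank M \<equiv> vec_space.rank (dim_row M) M"

text \<open>
  \<open>(d, dc)\<close>-repair property with \<open>(1 + \<epsilon>)\<close>-optimal repair bandwidth;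
  \<open>D i\<close> is the set of the \<open>dc\<close> compulsory helper nodes of node \<open>i\<close>.
\<close>

definition repair_property ::
  "nat \<Rightarrow> nat \<Rightarrow> nat \<Rightarrow> (nat \<Rightarrow> nat \<Rightarrow> 'a::field mat) \<Rightarrow> (nat \<Rightarrow> nat \<Rightarrow> 'a mat) \<Rightarrow>
   (nat \<Rightarrow> nat set) \<Rightarrow> nat \<Rightarrow> nat \<Rightarrow> real \<Rightarrow> bool" where
  "repair_property n k N A R D d dc \<epsilon> \<longleftrightarrow>
    (\<forall>i<n. D i \<subseteq> {..<n} - {i} \<and> card (D i) = dc \<and>
      (\<forall>H. H \<subseteq> {..<n} - {i} \<and> card H = d \<and> D i \<subseteq> H \<longrightarrow>
        recoverable (array_code n k N A) R i H \<and>
        real (\<Sum>j\<in>H. mat_rank (R i j))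
          \<le> (1 + \<epsilon>) * (real d / (real d - real k + 1)) * real N))"

text \<open>Digit \<open>i\<close> of the \<open>w\<close>-ary expansion of \<open>a\<close> with \<open>nb\<close> digits, digit 0 being the most significant.\<close>

definition digit :: "nat \<Rightarrow> nat \<Rightarrow> nat \<Rightarrow> nat \<Rightarrow> nat" where
  "digit w nb a i = (a div w ^ (nb - 1 - i)) mod w"

definition set_digit :: "nat \<Rightarrow> nat \<Rightarrow> nat \<Rightarrow> nat \<Rightarrow> nat \<Rightarrow> nat" where
  "set_digit w nb a i u =
    (\<Sum>j<nb. (if j = i then u else digit w nb a j) * w ^ (nb - 1 - j))"

definition lam :: "'a::field \<Rightarrow> nat \<Rightarrow> nat \<Rightarrow> 'a" where
  "lam c i u = (if u = 0 then c ^ (i + 1) else 1)"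

text \<open>
  The product \<open>unit_vec N a $ p * unit_vec N b $ l\<close> is entry \<open>(p, l)\<close> of the outer product of the
  basis vectors \<open>a\<close> and \<open>b\<close>.
\<close>

definition C3_node :: "nat \<Rightarrow> nat \<Rightarrow> 'a::field \<Rightarrow> (nat \<Rightarrow> 'a) \<Rightarrow> nat \<Rightarrow> 'a mat" where
  "C3_node w nb c x i =
    (let N = w ^ nb; ib = i mod nb in
     mat N N (\<lambda>(p, l). x i *
       (\<Sum>a<N. lam c ib (digit w nb a ib) *
          (unit_vec N a $ p *
           unit_vec N (set_digit w nb a ib ((digit w nb a ib + 1) mod w)) $ l))))"

definition C3_parity :: "nat \<Rightarrow> nat \<Rightarrow> 'a::field \<Rightarrow> (nat \<Rightarrow> 'a) \<Rightarrow> nat \<Rightarrow> nat \<Rightarrow> 'a mat" where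
  "C3_parity w nb c x t i = C3_node w nb c x i ^\<^sub>m t"

definition V0 :: "nat \<Rightarrow> nat \<Rightarrow> nat \<Rightarrow> 'a::field mat" where
  "V0 w nb i =
    mat_of_rows (w ^ nb) (map (unit_vec (w ^ nb)) (filter (\<lambda>a. digit w nb a i = 0) [0..<w ^ nb]))"

definition C3_repair :: "nat \<Rightarrow> nat \<Rightarrow> nat \<Rightarrow> nat \<Rightarrow> 'a::field mat" where
  "C3_repair w nb i j = (if j mod nb = i mod nb then 1\<^sub>m (w ^ nb) else V0 w nb (i mod nb))"

definition C3_compulsory :: "nat \<Rightarrow> nat \<Rightarrow> nat \<Rightarrow> nat set" where
  "C3_compulsory n nb i = {j. j < n \<and> j \<noteq> i \<and> j mod nb = i mod nb}"

end

theory Submission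
  imports Defs "HOL-Library.Function_Algebras"
begin

text \<open>
  The matrices \<open>A\<^sub>i\<close> commute, and \<open>A\<^sub>i\<^sup>w\<close> is the scalar \<open>\<mu>\<^sub>i\<close>, namely \<open>x\<^sub>i\<close> to the power \<open>w\<close> times \<open>c\<close> to
  the power \<open>(i mod nb) + 1\<close>. The hypotheses amount to the \<open>\<mu>\<^sub>i\<close> being pairwise distinct, which makes
  every difference of two node matrices injective: \<open>A\<^sub>i f = A\<^sub>j f\<close> implies \<open>\<mu>\<^sub>i f = \<mu>\<^sub>j f\<close>. Hence
  every block Vandermonde system in distinct nodes has only the trivial solution; this is the MDS
  property. For the repair of node \<open>i\<close>, restrict the parity equations to the positions whose digit
  \<open>i mod nb\<close> vanishes, a set respected by all nodes outside the residue class of \<open>i\<close>. The powers of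
  \<open>A\<^sub>i\<close> read off the \<open>w\<close> slices of \<open>f\<^sub>i\<close> there, periodically up to the factor \<open>\<mu>\<^sub>i\<close>; eliminating them
  leaves a block Vandermonde system for the \<open>r - w\<close> nodes that do not help.
\<close>

section \<open>Block Vandermonde systems of commuting additive maps\<close>

lemma sum_fun_apply: "(\<Sum>i\<in>I. f i) x = (\<Sum>i\<in>I. f i x :: 'a::comm_monoid_add)"
  by (induction I rule: infinite_finite_induct) auto

text \<open>
  Subtracting \<open>T l\<close> of the equation for \<open>t\<close> from the equation for \<open>t + 1\<close> removes the unknown \<open>z l\<close>
  and replaces each other \<open>z j\<close> by \<open>(T j - T l) (z j)\<close>.
\<close>

lemma commuting_vandermonde:
  fixes T :: "'i \<Rightarrow> 'v::ab_group_add \<Rightarrow> 'v"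
  assumes "finite U"
    and additive: "\<And>j. additive (T j)"
    and commute: "\<And>j l v. T j (T l v) = T l (T j v)"
    and range: "\<And>j v. T j v \<in> W"
    and diff: "\<And>v v'. v \<in> W \<Longrightarrow> v' \<in> W \<Longrightarrow> v - v' \<in> W"
    and inj: "\<And>j l v. j \<in> U \<Longrightarrow> l \<in> U \<Longrightarrow> j \<noteq> l \<Longrightarrow> v \<in> W \<Longrightarrow> T j v = T l v \<Longrightarrow> v = 0"
    and "\<And>j. j \<in> U \<Longrightarrow> z j \<in> W"
    and "\<And>t. t < card U \<Longrightarrow> (\<Sum>j\<in>U. (T j ^^ t) (z j)) = 0"
    and "j \<in> U"
  shows "z j = 0"
  using assms(1,6-)
proof (induction U arbitrary: z j rule: finite_induct)
  case empty
  then show ?case by simp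
next
  case (insert l U)
  have pow_diff: "(T j ^^ t) (v - v') = (T j ^^ t) v - (T j ^^ t) v'" for j t v v'
    by (induction t) (simp_all add: additive.diff[OF additive])
  have pow_commute: "(T j ^^ t) (T l v) = T l ((T j ^^ t) v)" for j t v
    by (induction t) (simp_all add: commute)
  define z' where "z' j = T j (z j) - T l (z j)" for j
  have z'0: "z' j = 0" if j: "j \<in> U" for j
  proof (rule insert.IH[of z'])
    fix t assume t: "t < card U"
    have eq: "(T j ^^ t) (z' j) = (T j ^^ Suc t) (z j) - T l ((T j ^^ t) (z j))" for j
      unfolding z'_def pow_diff pow_commute by (simp add: funpow_swap1)
    have "(\<Sum>j\<in>insert l U. (T j ^^ t) (z' j)) =
        (\<Sum>j\<in>insert l U. (T j ^^ Suc t) (z j)) - T l (\<Sum>j\<in>insert l U. (T j ^^ t) (z j))"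
      unfolding eq sum_subtractf additive.sum[OF additive] ..
    also have "\<dots> = 0"
      using insert.prems(3)[of "Suc t"] insert.prems(3)[of t] t insert.hyps
      by (simp add: additive.zero[OF additive] del: sum.insert)
    finally have "(T l ^^ t) (z' l) + (\<Sum>j\<in>U. (T j ^^ t) (z' j)) = 0"
      using insert.hyps by simp
    moreover have "(T l ^^ t) (z' l) = 0"
      using pow_diff[of t l 0 0] by (simp add: z'_def)
    ultimately show "(\<Sum>j\<in>U. (T j ^^ t) (z' j)) = 0" by simp
  qed (use insert.prems(1) j range diff in \<open>auto simp: z'_def\<close>)
  \<comment> \<open>\<open>z' j = 0\<close> says that \<open>T j\<close> and \<open>T l\<close>
    agree on \<open>z j\<close>, so the injectivity hypothesis applies.\<close>
  have zU: "z j = 0" if "j \<in> U" for j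
    using z'0[OF that] insert.prems(1)[of j l] insert.prems(2)[of j] insert.hyps(2) that
    by (auto simp: z'_def)
  have "z l = 0"
    using insert.prems(3)[of 0] insert.hyps zU by simp
  with zU insert.prems(4) show ?case by auto
qed

section \<open>Digit expansions\<close>

lemma digit_less: "0 < w \<Longrightarrow> digit w nb a i < w"
  by (simp add: digit_def)

lemma digit_expansion_Suc:
  "(\<Sum>j<Suc nb. D j * w ^ (Suc nb - 1 - j)) = w * (\<Sum>j<nb. D j * w ^ (nb - 1 - j)) + (D nb :: nat)"
proof -
  have "(\<Sum>j<nb. D j * w ^ (nb - j)) = (\<Sum>j<nb. w * (D j * w ^ (nb - 1 - j)))"
  proof (rule sum.cong)
    fix j assume "j \<in> {..<nb}"
    then have "nb - j = Suc (nb - 1 - j)" by auto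
    then show "D j * w ^ (nb - j) = w * (D j * w ^ (nb - 1 - j))" by simp
  qed simp
  then show ?thesis by (simp add: sum_distrib_left)
qed

lemma digit_Suc:
  assumes "i < nb"
  shows "digit w (Suc nb) a i = digit w nb (a div w) i"
proof -
  from assms have "Suc nb - 1 - i = Suc (nb - 1 - i)" by auto
  then show ?thesis by (simp add: digit_def div_mult2_eq)
qed

lemma digit_expansion:
  assumes "\<And>j. j < nb \<Longrightarrow> D j < w" and "i < nb"
  shows "digit w nb (\<Sum>j<nb. D j * w ^ (nb - 1 - j)) i = D i"
  using assms
proof (induction nb)
  case (Suc nb)
  have D: "D nb < w" using Suc.prems(1) by simp
  show ?case
  proof (cases "i = nb")
    case True
    then show ?thesis unfolding digit_expansion_Suc by (simp add: digit_def D)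
  next
    case False
    with Suc.prems(2) have "i < nb" by simp
    moreover have "(w * (\<Sum>j<nb. D j * w ^ (nb - 1 - j)) + D nb) div w = (\<Sum>j<nb. D j * w ^ (nb - 1 - j))"
      using D by simp
    ultimately show ?thesis unfolding digit_expansion_Suc using Suc
      by (simp only: digit_Suc)
  qed
qed simp

lemma digit_expansion_less:
  assumes "\<And>j. j < nb \<Longrightarrow> D j < w"
  shows "(\<Sum>j<nb. D j * w ^ (nb - 1 - j)) < (w ^ nb :: nat)"
  using assms
proof (induction nb)
  case (Suc nb)
  have "(\<Sum>j<nb. D j * w ^ (nb - 1 - j)) + 1 \<le> w ^ nb" using Suc by (simp add: Suc_le_eq)
  then have "w * ((\<Sum>j<nb. D j * w ^ (nb - 1 - j)) + 1) \<le> w * w ^ nb" by (rule mult_le_mono2)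
  moreover have "D nb < w" using Suc.prems by simp
  ultimately show ?case unfolding digit_expansion_Suc by (simp add: algebra_simps)
qed simp

text \<open>Reduces equations between \<open>set_digit\<close> terms to case distinctions on single
  digits.\<close>

lemma digits_eqI:
  assumes "a < w ^ nb" and "b < w ^ nb" and "\<And>j. j < nb \<Longrightarrow> digit w nb a j = digit w nb b j"
  shows "a = b"
  using assms
proof (induction nb arbitrary: a b)
  case (Suc nb)
  have "a div w = b div w"
  proof (rule Suc.IH)
    show "a div w < w ^ nb" "b div w < w ^ nb"
      using Suc.prems(1,2) by (simp_all add: less_mult_imp_div_less mult.commute)
    fix j assume "j < nb"
    then show "digit w nb (a div w) j = digit w nb (b div w) j"
      using Suc.prems(3)[of j] by (simp add: digit_Suc)
  qed
  moreover have "a mod w = b mod w"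
    using Suc.prems(3)[of nb] by (simp add: digit_def)
  ultimately show ?case by (metis div_mult_mod_eq)
qed simp

lemma set_digit_less: "u < w \<Longrightarrow> set_digit w nb a i u < w ^ nb"
  unfolding set_digit_def by (rule digit_expansion_less) (auto simp: digit_less)

lemma digit_set_digit:
  "u < w \<Longrightarrow> j < nb \<Longrightarrow> digit w nb (set_digit w nb a i u) j = (if j = i then u else digit w nb a j)"
  unfolding set_digit_def by (subst digit_expansion) (auto simp: digit_less)

lemma set_digit_commute:
  assumes "u < w" "v < w" "i \<noteq> j"
  shows "set_digit w nb (set_digit w nb a i u) j v = set_digit w nb (set_digit w nb a j v) i u"
  by (rule digits_eqI[of _ w nb]) (use assms in \<open>auto simp: digit_set_digit set_digit_less\<close>)

lemma set_digit_overwrite: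
  assumes "u < w" "v < w"
  shows "set_digit w nb (set_digit w nb a i u) i v = set_digit w nb a i v"
  by (rule digits_eqI[of _ w nb]) (use assms in \<open>auto simp: digit_set_digit set_digit_less\<close>)

lemma set_digit_same:
  assumes "a < w ^ nb" "0 < w"
  shows "set_digit w nb a i (digit w nb a i) = a"
  by (rule digits_eqI[of _ w nb])
    (use assms in \<open>auto simp: digit_set_digit set_digit_less digit_less\<close>)

text \<open>Overwriting digit \<open>i\<close> by each \<open>u < w\<close> maps the pairs
  \<open>(a, u)\<close> injectively below \<open>w ^ nb\<close>: digit \<open>i\<close> of the
  result is \<open>u\<close>, and its other digits, together with the known digit 0, determine
  \<open>a\<close>.\<close>

lemma card_digit_zero:
  assumes "0 < w" "i < nb"
  shows "card {a. a < w ^ nb \<and> digit w nb a i = 0} * w \<le> w ^ nb"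
proof -
  let ?S = "{a. a < w ^ nb \<and> digit w nb a i = 0}"
  have "inj_on (\<lambda>(a, u). set_digit w nb a i u) (?S \<times> {..<w})"
  proof (rule inj_onI, clarsimp)
    fix a u b v
    assume *: "a < w ^ nb" "digit w nb a i = 0" "u < w" "b < w ^ nb" "digit w nb b i = 0" "v < w"
      "set_digit w nb a i u = set_digit w nb b i v"
    have "digit w nb a j = digit w nb b j" if "j < nb" for j
      using arg_cong[OF *(7), of "\<lambda>a. digit w nb a j"] *(1-6) that
      by (cases "j = i") (simp_all add: digit_set_digit)
    moreover have "u = v"
      using arg_cong[OF *(7), of "\<lambda>a. digit w nb a i"] *(1-6) assms by (simp add: digit_set_digit)
    ultimately show "a = b \<and> u = v" using digits_eqI * by blast
  qed
  then have "card (?S \<times> {..<w}) \<le> card {..<w ^ nb}"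
    by (rule card_inj_on_le) (auto simp: set_digit_less)
  then show ?thesis by (simp add: card_cartesian_product)
qed

section \<open>The node matrices as operators on functions\<close>

text \<open>Column vectors of length \<open>N\<close> are modelled as functions vanishing from
  \<open>N\<close> on. These live in a type that is an additive group, as
  \<open>commuting_vandermonde\<close> requires.\<close>

definition supported :: "nat \<Rightarrow> (nat \<Rightarrow> 'a::zero) set" where
  "supported N = {f. \<forall>a\<ge>N. f a = 0}"

lemma supported_diff: "f \<in> supported N \<Longrightarrow> g \<in> supported N \<Longrightarrow> f - g \<in> supported (N :: nat)"
  for f g :: "nat \<Rightarrow> 'a::ab_group_add"
  by (simp add: supported_def)

text \<open>The action of \<open>C3_node\<close> on such functions: row \<open>a\<close> of the
  matrix has at most one nonzero entry. The value 0 beyond \<open>w ^ nb\<close> keeps every image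
  in \<open>supported (w ^ nb)\<close>, whatever \<open>f\<close> is.\<close>

definition node_op ::
  "nat \<Rightarrow> nat \<Rightarrow> 'a::field \<Rightarrow> (nat \<Rightarrow> 'a) \<Rightarrow> nat \<Rightarrow> (nat \<Rightarrow> 'a) \<Rightarrow> nat \<Rightarrow> 'a" where
  "node_op w nb c x i f = (\<lambda>a. if a < w ^ nb
     then x i * lam c (i mod nb) (digit w nb a (i mod nb)) *
       f (set_digit w nb a (i mod nb) ((digit w nb a (i mod nb) + 1) mod w))
     else 0)"

definition node_const :: "nat \<Rightarrow> nat \<Rightarrow> 'a::field \<Rightarrow> (nat \<Rightarrow> 'a) \<Rightarrow> nat \<Rightarrow> 'a" where
  "node_const w nb c x i = x i ^ w * c ^ (i mod nb + 1)"

lemma additive_node_op: "additive (node_op w nb c x i)"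
  by unfold_locales (auto simp: node_op_def fun_eq_iff algebra_simps)

lemma node_op_supported: "node_op w nb c x i f \<in> supported (w ^ nb)"
  by (simp add: node_op_def supported_def)

lemma node_op_pow_supported: "f \<in> supported (w ^ nb) \<Longrightarrow> (node_op w nb c x i ^^ t) f \<in> supported (w ^ nb)"
  by (induction t) (simp_all add: node_op_supported)

lemma node_op_pow_diff:
  "(node_op w nb c x i ^^ t) (f - g) = (node_op w nb c x i ^^ t) f - (node_op w nb c x i ^^ t) g"
  by (induction t) (simp_all only: funpow.simps comp_apply id_apply additive.diff[OF additive_node_op])

lemma node_op_scale: "node_op w nb c x i (\<lambda>a. \<alpha> * f a) = (\<lambda>a. \<alpha> * node_op w nb c x i f a)"
  by (auto simp: node_op_def fun_eq_iff)

lemma node_op_pow_scale: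
  "(node_op w nb c x i ^^ t) (\<lambda>a. \<alpha> * f a) = (\<lambda>a. \<alpha> * (node_op w nb c x i ^^ t) f a)"
  by (induction t) (simp_all add: node_op_scale)

lemma lam_nonzero: "c \<noteq> 0 \<Longrightarrow> lam c i u \<noteq> 0"
  by (simp add: lam_def)

text \<open>Adding \<open>e\<close> permutes the residues modulo \<open>w\<close>, so the product
  runs over all digit values, of which only 0 can contribute a factor other than 1.\<close>

lemma prod_lam_cyclic:
  assumes "0 < w"
  shows "(\<Prod>u<w. lam c i ((e + u) mod w)) = c ^ (i + 1)"
proof -
  have inj: "inj_on (\<lambda>u. (e + u) mod w) {..<w}"
  proof (rule inj_onI)
    fix u v assume *: "u \<in> {..<w}" "v \<in> {..<w}" "(e + u) mod w = (e + v) mod w"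
    then have "u mod w = v mod w"
      unfolding nat_mod_eq_iff by (simp add: add.assoc)
    with * show "u = v" by simp
  qed
  have "(\<lambda>u. (e + u) mod w) ` {..<w} = {..<w}"
    by (rule card_subset_eq) (use assms in \<open>auto simp: card_image[OF inj]\<close>)
  then have "(\<Prod>u<w. lam c i ((e + u) mod w)) = (\<Prod>u<w. lam c i u)"
    by (metis (no_types, lifting) inj prod.reindex_cong)
  also obtain v where "w = Suc v" using assms by (cases w) auto
  then have "(\<Prod>u<w. lam c i u) = c ^ (i + 1)"
    by (simp only: prod.lessThan_Suc_shift) (simp add: lam_def)
  finally show ?thesis .
qed

text \<open>Selects the same coordinates as \<open>V0\<close>, but fills the others with 0 instead
  of dropping them, so that \<open>node_op\<close> still applies.\<close>

definition zero_digit_part :: "nat \<Rightarrow> nat \<Rightarrow> nat \<Rightarrow> (nat \<Rightarrow> 'a::zero) \<Rightarrow> nat \<Rightarrow> 'a" where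
  "zero_digit_part w nb m f = (\<lambda>a. if digit w nb a m = 0 then f a else 0)"

context
  fixes w nb :: nat and c :: "'a::field" and x :: "nat \<Rightarrow> 'a"
  assumes w: "2 \<le> w" and nb: "0 < nb"
begin

private abbreviation T :: "nat \<Rightarrow> (nat \<Rightarrow> 'a) \<Rightarrow> nat \<Rightarrow> 'a" where
  "T \<equiv> node_op w nb c x"

private abbreviation \<mu> :: "nat \<Rightarrow> 'a" where
  "\<mu> \<equiv> node_const w nb c x"

private abbreviation W :: "(nat \<Rightarrow> 'a) set" where
  "W \<equiv> supported (w ^ nb)"

text \<open>Nodes with different residues modulo \<open>nb\<close> change different digits, and the
  factor \<open>lam\<close> of each depends only on its own digit. With equal residues both
  operators are multiples of one common operator.\<close>

lemma node_op_commute: "T i (T j f) = T j (T i f)"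
proof (rule ext)
  fix a
  have "i mod nb < nb" "j mod nb < nb" using nb by auto
  then show "T i (T j f) a = T j (T i f) a"
    using w by (cases "i mod nb = j mod nb")
      (simp_all add: node_op_def set_digit_less digit_set_digit set_digit_commute)
qed

text \<open>Each application advances digit \<open>m\<close> by one modulo \<open>w\<close> and
  collects one factor. Hence at positions with digit 0 the powers \<open>t < w\<close> read
  \<open>f\<close> on the slice with digit \<open>t\<close>, which is what repair exploits.\<close>

lemma node_op_pow:
  assumes "a < w ^ nb" and m_def: "m = i mod nb"
  shows "(T i ^^ t) f a =
    (\<Prod>u<t. x i * lam c m ((digit w nb a m + u) mod w)) *
      f (set_digit w nb a m ((digit w nb a m + t) mod w))"
  using assms(1)
proof (induction t arbitrary: a)
  case 0
  then show ?case using w by (simp add: digit_less set_digit_same)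
next
  case (Suc t)
  let ?e = "digit w nb a m"
  \<comment> \<open>\<open>?b\<close> is the position that the outermost \<open>T i\<close> reads;
    the induction hypothesis is applied there, so the new factor enters the product at
    \<open>u = 0\<close>.\<close>
  let ?b = "set_digit w nb a m (Suc ?e mod w)"
  have m: "m < nb" using nb by (simp add: m_def)
  have "digit w nb ?b m = Suc ?e mod w" "?b < w ^ nb"
    using w m by (simp_all add: digit_set_digit set_digit_less)
  then have "(T i ^^ t) f ?b = (\<Prod>u<t. x i * lam c m ((?e + Suc u) mod w)) *
      f (set_digit w nb a m ((?e + Suc t) mod w))"
    using Suc.IH[of ?b] w by (simp add: set_digit_overwrite mod_simps)
  then show ?case
    using Suc.prems w prod.lessThan_Suc_shift[of "\<lambda>u. x i * lam c m ((?e + u) mod w)" t]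
    by (auto simp: node_op_def[of _ _ _ _ _ "(T i ^^ t) f"] digit_less mult.assoc
        simp del: prod.lessThan_Suc simp flip: m_def)
qed

text \<open>After \<open>w\<close> steps the digit is back at its start, and the collected factors
  run through a full cycle.\<close>

lemma node_op_pow_w:
  assumes "f \<in> W"
  shows "(T i ^^ w) f = (\<lambda>a. \<mu> i * f a)"
proof (rule ext)
  fix a
  show "(T i ^^ w) f a = \<mu> i * f a"
  proof (cases "a < w ^ nb")
    case True
    then show ?thesis
      using w by (simp add: node_op_pow prod.distrib prod_lam_cyclic digit_less set_digit_same node_const_def)
  next
    case False
    then show ?thesis
      using assms node_op_pow_supported[OF assms, of w c x i] by (simp add: supported_def)
  qed
qed

text \<open>Because the operators commute, the equation passes to all their powers; at exponent
  \<open>w\<close> it compares two scalars.\<close>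

lemma node_op_inj:
  assumes "\<mu> i \<noteq> \<mu> j" and f: "f \<in> W" and eq: "T i f = T j f"
  shows "f = 0"
proof (rule ext)
  fix a
  have "(T i ^^ t) f = (T j ^^ t) f" for t
  proof (induction t)
    case (Suc t)
    have "T i ((T j ^^ t) f) = (T j ^^ t) (T i f)"
      by (induction t) (simp_all add: node_op_commute[of i j])
    then show ?case using Suc eq by (simp add: funpow_swap1)
  qed simp
  from this[of w] have "\<mu> i * f a = \<mu> j * f a"
    unfolding node_op_pow_w[OF f] by (rule fun_cong)
  then show "f a = 0 a" using assms(1) by simp
qed

text \<open>The index map \<open>J\<close> serves both uses: a choice of block columns for the MDS
  property, the identity for repair.\<close>

lemma node_op_vandermonde:
  fixes J :: "'i \<Rightarrow> nat"
  assumes "finite U" and "inj_on (\<mu> \<circ> J) U"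
    and "\<And>j. j \<in> U \<Longrightarrow> z j \<in> W"
    and "\<And>t. t < card U \<Longrightarrow> (\<Sum>j\<in>U. (T (J j) ^^ t) (z j)) = 0"
    and "j \<in> U"
  shows "z j = 0"
proof (rule commuting_vandermonde[where T = "\<lambda>j. T (J j)" and W = W and U = U and z = z])
  fix j l and v
  assume "j \<in> U" "l \<in> U" "j \<noteq> l" "v \<in> W" "T (J j) v = T (J l) v"
  then show "v = 0" using node_op_inj[of "J j" "J l" v] inj_onD[OF assms(2), of j l] by auto
qed (use assms in \<open>auto simp: additive_node_op node_op_commute node_op_supported supported_diff\<close>)

section \<open>Restriction to the positions with a zero digit\<close>

lemma additive_zero_digit_part:
  "additive (zero_digit_part w nb m :: (nat \<Rightarrow> 'a) \<Rightarrow> nat \<Rightarrow> 'a)"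
  by unfold_locales (auto simp: zero_digit_part_def fun_eq_iff)

text \<open>Such a node moves a digit other than \<open>m\<close>, so it neither enters nor leaves
  the positions with digit \<open>m\<close> equal to 0.\<close>

lemma zero_digit_part_node_op:
  assumes "m < nb" "j mod nb \<noteq> m"
  shows "zero_digit_part w nb m (T j f) = T j (zero_digit_part w nb m f)"
  using assms w by (auto simp: zero_digit_part_def node_op_def fun_eq_iff digit_set_digit)

lemma zero_digit_part_node_op_pow:
  assumes "m < nb" "j mod nb \<noteq> m"
  shows "zero_digit_part w nb m ((T j ^^ t) f) = (T j ^^ t) (zero_digit_part w nb m f)"
  by (induction t) (simp_all add: zero_digit_part_node_op[OF assms])

lemma zero_digit_part_supported: "f \<in> W \<Longrightarrow> zero_digit_part w nb m f \<in> W"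
  by (simp add: supported_def zero_digit_part_def)

text \<open>
  On the positions with digit \<open>m = i mod nb\<close> equal to 0, the \<open>t\<close>-th parity equation involves only the
  zero-digit parts of the nodes outside the residue class of \<open>i\<close>, plus the term \<open>G t\<close> of node \<open>i\<close>,
  and \<open>G (t + w) = \<mu> i G t\<close>. Eliminating \<open>G\<close> leaves a block Vandermonde system for the
  \<open>r - w\<close> nodes that do not help.
\<close>

lemma repair_kernel:
  assumes c: "c \<noteq> 0" and x: "x i \<noteq> 0"
    and I: "finite I" "i \<in> I" "inj_on \<mu> I"
    and H: "H \<subseteq> I - {i}" "{j \<in> I. j \<noteq> i \<and> j mod nb = i mod nb} \<subseteq> H"
    and r: "w + card (I - {i} - H) = r"
    and F: "\<And>j. j \<in> I \<Longrightarrow> F j \<in> W"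
    and parity: "\<And>t. t < r \<Longrightarrow> (\<Sum>j\<in>I. (T j ^^ t) (F j)) = 0"
    and same: "\<And>j. j \<in> H \<Longrightarrow> j mod nb = i mod nb \<Longrightarrow> F j = 0"
    and other: "\<And>j. j \<in> H \<Longrightarrow> j mod nb \<noteq> i mod nb \<Longrightarrow> zero_digit_part w nb (i mod nb) (F j) = 0"
  shows "F i = 0"
proof -
  define m where "m = i mod nb"
  have m: "m < nb" using nb by (simp add: m_def)
  define P :: "(nat \<Rightarrow> 'a) \<Rightarrow> nat \<Rightarrow> 'a" where "P = zero_digit_part w nb m"
  \<comment> \<open>The nodes, apart from \<open>i\<close>, about which nothing is known. The rest
    of the residue class of \<open>i\<close> helps, so \<open>P\<close> commutes with the operators
    of \<open>U\<close>.\<close>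
  define U where "U = I - {i} - H"
  define G where "G t = P ((T i ^^ t) (F i))" for t
  interpret P: additive P unfolding P_def by (rule additive_zero_digit_part)
  have U: "finite U" "U \<subseteq> I" "\<And>j. j \<in> U \<Longrightarrow> j mod nb \<noteq> m" "card U = r - w" "i \<notin> U"
    using I H r by (auto simp: U_def m_def)
  have T0: "(T j ^^ t) 0 = 0" for j t
    using node_op_pow_diff[of t w nb c x j 0 0] by simp
  \<comment> \<open>The restricted parity equation solved for node \<open>i\<close>. Helpers drop
    out: in the class of \<open>i\<close> because \<open>F j = 0\<close>, otherwise because
    \<open>P\<close> commutes with \<open>T j\<close> and \<open>P (F j) = 0\<close>.\<close>
  have G: "G t = - (\<Sum>j\<in>U. (T j ^^ t) (P (F j)))" if "t < r" for t
  proof -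
    have "0 = P (\<Sum>j\<in>I. (T j ^^ t) (F j))" using parity[OF that] P.zero by simp
    also have "\<dots> = (\<Sum>j\<in>I. P ((T j ^^ t) (F j)))" by (rule P.sum)
    also have "I = insert i U \<union> H" using I H by (auto simp: U_def)
    also have "(\<Sum>j\<in>insert i U \<union> H. P ((T j ^^ t) (F j))) = (\<Sum>j\<in>insert i U. P ((T j ^^ t) (F j)))"
    proof (rule sum.mono_neutral_right)
      show "\<forall>j\<in>insert i U \<union> H - insert i U. P ((T j ^^ t) (F j)) = 0"
      proof
        fix j assume "j \<in> insert i U \<union> H - insert i U"
        then have j: "j \<in> H" by auto
        show "P ((T j ^^ t) (F j)) = 0"
        proof (cases "j mod nb = m")
          case True
          then show ?thesis using same[OF j] by (simp add: m_def T0 P.zero)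
        next
          case False
          then show ?thesis
            using other[OF j] unfolding P_def zero_digit_part_node_op_pow[OF m False]
            by (simp add: m_def T0)
        qed
      qed
    qed (use U I H in \<open>auto intro: finite_subset\<close>)
    also have "\<dots> = G t + (\<Sum>j\<in>U. P ((T j ^^ t) (F j)))"
      using U by (simp add: G_def)
    also have "(\<Sum>j\<in>U. P ((T j ^^ t) (F j))) = (\<Sum>j\<in>U. (T j ^^ t) (P (F j)))"
      unfolding P_def by (rule sum.cong) (simp_all add: zero_digit_part_node_op_pow[OF m] U)
    finally show ?thesis by (metis eq_neg_iff_add_eq_0)
  qed
  have G_shift: "G (t + w) = (\<lambda>a. \<mu> i * G t a)" for t
    unfolding G_def funpow_add comp_def node_op_pow_w[OF F[OF I(2)]] node_op_pow_scale
    by (auto simp: P_def zero_digit_part_def)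
  have PF0: "P (F j) = 0" if j: "j \<in> U" for j
  proof -
    \<comment> \<open>Inserting \<open>G\<close> into \<open>G_shift\<close>, and using that
      \<open>T j ^^ w\<close> multiplies \<open>P (F j)\<close> by \<open>\<mu> j\<close>, gives the
      weights \<open>\<mu> j - \<mu> i\<close>. Both \<open>G t\<close> and \<open>G (t + w)\<close>
      are available for \<open>t < r - w\<close>, which is exactly
      \<open>t < card U\<close>.\<close>
    define z where "z j = (\<lambda>a. (\<mu> j - \<mu> i) * P (F j) a)" for j
    have PF: "P (F j) \<in> W" if "j \<in> U" for j
      using F U that by (auto simp: P_def intro: zero_digit_part_supported)
    have "z j = 0"
    proof (rule node_op_vandermonde[where J = "\<lambda>j. j", OF U(1) _ _ _ j])
      show "inj_on (\<mu> \<circ> (\<lambda>j. j)) U" using inj_on_subset[OF I(3) U(2)] by (simp add: comp_def)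
      show "z j \<in> W" if "j \<in> U" for j
        using PF[OF that] by (simp add: z_def supported_def)
      fix t assume "t < card U"
      then have t: "t < r" "t + w < r" using U(4) by auto
      have "(\<Sum>j\<in>U. (T j ^^ t) (z j)) =
          (\<Sum>j\<in>U. (T j ^^ (t + w)) (P (F j)) - (\<lambda>a. \<mu> i * (T j ^^ t) (P (F j)) a))"
      proof (rule sum.cong)
        fix j assume "j \<in> U"
        then show "(T j ^^ t) (z j) = (T j ^^ (t + w)) (P (F j)) - (\<lambda>a. \<mu> i * (T j ^^ t) (P (F j)) a)"
          unfolding funpow_add comp_def z_def by (simp add: node_op_pow_w[OF PF] node_op_pow_scale)
            (simp add: fun_eq_iff algebra_simps)
      qed simp
      also have "\<dots> = 0"
      proof (rule ext)
        fix a
        have "(\<Sum>j\<in>U. (T j ^^ (t + w)) (P (F j)) a) = \<mu> i * (\<Sum>j\<in>U. (T j ^^ t) (P (F j)) a)"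
          using fun_cong[OF G_shift[of t], of a] unfolding G[OF t(1)] G[OF t(2)]
          by (simp add: sum_fun_apply)
        then show "(\<Sum>j\<in>U. (T j ^^ (t + w)) (P (F j)) - (\<lambda>a. \<mu> i * (T j ^^ t) (P (F j)) a)) a = 0 a"
          by (simp add: sum_fun_apply sum_subtractf sum_distrib_left)
      qed
      finally show "(\<Sum>j\<in>U. (T j ^^ t) (z j)) = 0" .
    qed
    moreover have "\<mu> j \<noteq> \<mu> i" using j U I by (metis inj_onD subsetD)
    ultimately show ?thesis by (auto simp: z_def fun_eq_iff)
  qed
  have G0: "G t = 0" if "t < r" for t
    using G[OF that] PF0 by (simp add: T0)
  show ?thesis
  proof (rule ext)
    fix b
    show "F i b = 0 b"
    proof (cases "b < w ^ nb")
      case True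
      \<comment> \<open>\<open>t\<close> is the digit of \<open>b\<close> that \<open>a\<close>
        resets to 0, so \<open>G t\<close> evaluated at \<open>a\<close> is a nonzero multiple of
        \<open>F i b\<close>; \<open>t < w \<le> r\<close> makes \<open>G0\<close>
        applicable.\<close>
      define a where "a = set_digit w nb b m 0"
      define t where "t = digit w nb b m"
      have t: "t < w" using w by (simp add: t_def digit_less)
      have a: "a < w ^ nb" "digit w nb a m = 0" "set_digit w nb a m t = b"
        using w m t True by (auto simp: a_def set_digit_less digit_set_digit set_digit_overwrite)
          (simp add: t_def set_digit_same)
      have "G t a = 0" using G0[of t] t r by simp
      then have "(\<Prod>u<t. x i * lam c m (u mod w)) * F i b = 0"
        using node_op_pow[OF a(1) m_def, of t "F i"] a t
        by (simp add: G_def P_def zero_digit_part_def flip: m_def)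
      then show ?thesis using c x by (simp add: lam_nonzero)
    next
      case False
      then show ?thesis using F[OF I(2)] by (simp add: supported_def)
    qed
  qed
qed

end

section \<open>Matrices, codewords and repair\<close>

definition vec_fun :: "nat \<Rightarrow> 'a::zero vec \<Rightarrow> nat \<Rightarrow> 'a" where
  "vec_fun N v = (\<lambda>a. if a < N then v $ a else 0)"

lemma vec_fun_supported: "vec_fun N v \<in> supported N"
  by (simp add: vec_fun_def supported_def)

lemma C3_node_carrier: "C3_node w nb c x i \<in> carrier_mat (w ^ nb) (w ^ nb)"
  by (simp add: C3_node_def Let_def)

lemma C3_node_index:
  assumes "p < w ^ nb" "l < w ^ nb" "0 < w" and m_def: "m = i mod nb"
  shows "C3_node w nb c x i $$ (p, l) = x i * lam c m (digit w nb p m) *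
    (if l = set_digit w nb p m ((digit w nb p m + 1) mod w) then 1 else 0)"
proof -
  let ?g = "\<lambda>a. lam c m (digit w nb a m) *
    unit_vec (w ^ nb) (set_digit w nb a m ((digit w nb a m + 1) mod w)) $ l"
  have "(\<Sum>a<w ^ nb. lam c m (digit w nb a m) * (unit_vec (w ^ nb) a $ p *
      unit_vec (w ^ nb) (set_digit w nb a m ((digit w nb a m + 1) mod w)) $ l)) =
    (\<Sum>a<w ^ nb. if a = p then ?g a else 0)"
    by (rule sum.cong) (use assms in auto)
  also have "\<dots> = ?g p" using assms by simp
  finally show ?thesis
    using assms(1-3) by (simp add: C3_node_def Let_def set_digit_less flip: m_def)
qed

lemma vec_fun_C3_node:
  assumes "v \<in> carrier_vec (w ^ nb)" "0 < w"
  shows "vec_fun (w ^ nb) (C3_node w nb c x i *\<^sub>v v) = node_op w nb c x i (vec_fun (w ^ nb) v)"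
proof (rule ext)
  fix p
  define q where "q = set_digit w nb p (i mod nb) ((digit w nb p (i mod nb) + 1) mod w)"
  have q: "q < w ^ nb" using assms by (simp add: q_def set_digit_less)
  show "vec_fun (w ^ nb) (C3_node w nb c x i *\<^sub>v v) p = node_op w nb c x i (vec_fun (w ^ nb) v) p"
  proof (cases "p < w ^ nb")
    case True
    have "(C3_node w nb c x i *\<^sub>v v) $ p = (\<Sum>l<w ^ nb. C3_node w nb c x i $$ (p, l) * v $ l)"
      using True assms C3_node_carrier[of w nb c x i]
      by (auto simp: scalar_prod_def lessThan_atLeast0)
    also have "\<dots> = (\<Sum>l<w ^ nb. if l = q
        then x i * lam c (i mod nb) (digit w nb p (i mod nb)) * v $ l else 0)"
      by (rule sum.cong) (use True assms in \<open>auto simp: C3_node_index[OF _ _ _ refl] q_def\<close>)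
    also have "\<dots> = x i * lam c (i mod nb) (digit w nb p (i mod nb)) * v $ q"
      using q by simp
    finally show ?thesis using True q by (simp add: vec_fun_def node_op_def q_def)
  qed (simp add: vec_fun_def node_op_def)
qed

lemma C3_parity_carrier: "C3_parity w nb c x t i \<in> carrier_mat (w ^ nb) (w ^ nb)"
  unfolding C3_parity_def by (rule pow_carrier_mat[OF C3_node_carrier])

lemma vec_fun_C3_parity:
  assumes "v \<in> carrier_vec (w ^ nb)" "0 < w"
  shows "vec_fun (w ^ nb) (C3_parity w nb c x t i *\<^sub>v v) = (node_op w nb c x i ^^ t) (vec_fun (w ^ nb) v)"
  using assms(1)
proof (induction t arbitrary: v)
  case 0
  then show ?case
    using C3_node_carrier[of w nb c x i] by (simp add: C3_parity_def)
next
  case (Suc t)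
  let ?A = "C3_node w nb c x i"
  have A: "?A \<in> carrier_mat (w ^ nb) (w ^ nb)" by (rule C3_node_carrier)
  have "?A ^\<^sub>m Suc t *\<^sub>v v = ?A ^\<^sub>m t *\<^sub>v (?A *\<^sub>v v)"
    using assoc_mult_mat_vec[OF pow_carrier_mat[OF A] A Suc.prems] by simp
  then show ?case
    using Suc.IH[of "?A *\<^sub>v v"] A Suc.prems vec_fun_C3_node[OF Suc.prems assms(2)]
    by (simp add: C3_parity_def funpow_swap1)
qed

lemma array_code_parity:
  assumes f: "f \<in> array_code n k (w ^ nb) (C3_parity w nb c x)" and "t < n - k" and "0 < w"
  shows "(\<Sum>j<n. (node_op w nb c x j ^^ t) (vec_fun (w ^ nb) (f j))) = 0"
proof (rule ext)
  fix p
  have f_carrier: "f j \<in> carrier_vec (w ^ nb)" if "j < n" for j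
    using f that by (auto simp: array_code_def)
  have "(\<Sum>j<n. vec_fun (w ^ nb) (C3_parity w nb c x t j *\<^sub>v f j) p) = 0"
  proof (cases "p < w ^ nb")
    case True
    have "(\<lambda>j. C3_parity w nb c x t j *\<^sub>v f j) \<in> {..<n} \<rightarrow> carrier_vec (w ^ nb)"
      using f_carrier mult_mat_vec_carrier[OF C3_parity_carrier] by blast
    then have "(\<Sum>j<n. (C3_parity w nb c x t j *\<^sub>v f j) $ p) =
        finsum_vec TYPE('a) (w ^ nb) (\<lambda>j. C3_parity w nb c x t j *\<^sub>v f j) {..<n} $ p"
      using True by (simp add: index_finsum_vec)
    also have "\<dots> = 0" using f assms(2) True by (simp add: array_code_def)
    finally show ?thesis using True by (simp add: vec_fun_def)
  qed (simp add: vec_fun_def)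
  then show "(\<Sum>j<n. (node_op w nb c x j ^^ t) (vec_fun (w ^ nb) (f j))) p = 0 p"
    by (simp add: sum_fun_apply vec_fun_C3_parity f_carrier \<open>0 < w\<close>)
qed

section \<open>The MDS property\<close>

text \<open>A kernel vector of a singular sub-block matrix is cut into \<open>n - k\<close> blocks
  of length \<open>w ^ nb\<close>; these solve a block Vandermonde system in distinct nodes, so they
  all vanish.\<close>

lemma is_MDS_C3:
  assumes "2 \<le> w" "0 < nb" and inj: "inj_on (node_const w nb c x) {..<n}"
  shows "is_MDS n k (w ^ nb) (C3_parity w nb c x)"
  unfolding is_MDS_def
proof (intro allI impI notI, elim conjE)
  fix J
  define N r where "N = w ^ nb" and "r = n - k"
  let ?A = "C3_parity w nb c x"
  let ?M = "sub_block_mat r N ?A J"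
  assume J: "strict_mono_on {..<n - k} J" "J ` {..<n - k} \<subseteq> {..<n}"
    and "det (sub_block_mat (n - k) (w ^ nb) ?A J) = 0"
  then have "det ?M = 0" by (simp add: N_def r_def)
  moreover have "?M \<in> carrier_mat (r * N) (r * N)" by (simp add: sub_block_mat_def)
  ultimately obtain v where v: "v \<in> carrier_vec (r * N)" "v \<noteq> 0\<^sub>v (r * N)" "?M *\<^sub>v v = 0\<^sub>v (r * N)"
    using det_0_iff_vec_prod_zero by blast
  have N: "0 < N" using assms by (simp add: N_def)
  have bound: "l * N + a < r * N" if "l < r" "a < N" for l a
  proof -
    have "l * N + a < Suc l * N" using that by simp
    also have "\<dots> \<le> r * N" using that by (intro mult_le_mono1) simp
    finally show ?thesis .
  qed
  define z where "z l = vec N (\<lambda>a. v $ (l * N + a))" for l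
  have z: "z l \<in> carrier_vec N" for l by (simp add: z_def)
  have block: "(\<Sum>l<r. (?A t (J l) *\<^sub>v z l) $ p) = 0" if "t < r" "p < N" for t p
  proof -
    have "0 = (?M *\<^sub>v v) $ (t * N + p)" using v(3) bound[OF that] by simp
    also have "\<dots> = (\<Sum>q<r * N. ?A t (J (q div N)) $$ (p, q mod N) * v $ q)"
      using v(1) bound[OF that] that N
      by (auto simp: sub_block_mat_def scalar_prod_def lessThan_atLeast0 intro!: sum.cong)
    also have "\<dots> = (\<Sum>l<r. \<Sum>q\<in>{l * N..<l * N + N}. ?A t (J (q div N)) $$ (p, q mod N) * v $ q)"
      by (rule sum.nat_group[symmetric])
    also have "\<dots> = (\<Sum>l<r. \<Sum>a<N. ?A t (J l) $$ (p, a) * v $ (l * N + a))"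
    proof (rule sum.cong)
      fix l
      have "(\<Sum>q\<in>{l * N..<l * N + N}. ?A t (J (q div N)) $$ (p, q mod N) * v $ q) =
          (\<Sum>a<N. ?A t (J ((a + l * N) div N)) $$ (p, (a + l * N) mod N) * v $ (a + l * N))"
        using sum.shift_bounds_nat_ivl[of "\<lambda>q. ?A t (J (q div N)) $$ (p, q mod N) * v $ q" 0 "l * N" N]
        by (simp only: lessThan_atLeast0 add.commute add_0)
      also have "\<dots> = (\<Sum>a<N. ?A t (J l) $$ (p, a) * v $ (l * N + a))"
        by (rule sum.cong) (auto simp: add.commute)
      finally show "(\<Sum>q\<in>{l * N..<l * N + N}. ?A t (J (q div N)) $$ (p, q mod N) * v $ q) =
        (\<Sum>a<N. ?A t (J l) $$ (p, a) * v $ (l * N + a))" .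
    qed simp
    also have "\<dots> = (\<Sum>l<r. (?A t (J l) *\<^sub>v z l) $ p)"
    proof (rule sum.cong)
      fix l
      have "?A t (J l) \<in> carrier_mat N N" unfolding N_def by (rule C3_parity_carrier)
      then show "(\<Sum>a<N. ?A t (J l) $$ (p, a) * v $ (l * N + a)) = (?A t (J l) *\<^sub>v z l) $ p"
        using that by (auto simp: scalar_prod_def z_def lessThan_atLeast0)
    qed simp
    finally show ?thesis by simp
  qed
  have z_fun: "vec_fun N (z l) = 0" if "l < r" for l
  proof (rule node_op_vandermonde[OF assms(1,2), where J = J and U = "{..<r}"])
    have "inj_on J {..<r}" using J(1) strict_mono_on_imp_inj_on by (auto simp: r_def)
    then show "inj_on (node_const w nb c x \<circ> J) {..<r}"
      using inj_on_subset[OF inj J(2)] by (auto simp: r_def intro: comp_inj_on)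
    show "vec_fun N (z l) \<in> supported (w ^ nb)" for l
      unfolding N_def by (rule vec_fun_supported)
    fix t assume "t < card {..<r}"
    then have t: "t < r" by simp
    show "(\<Sum>l<r. (node_op w nb c x (J l) ^^ t) (vec_fun N (z l))) = 0"
    proof (rule ext)
      fix p
      have "(\<Sum>l<r. vec_fun N (?A t (J l) *\<^sub>v z l) p) = 0"
        using block[OF t, of p] by (cases "p < N") (simp_all add: vec_fun_def)
      then show "(\<Sum>l<r. (node_op w nb c x (J l) ^^ t) (vec_fun N (z l))) p = 0 p"
        using vec_fun_C3_parity[of "z _" w nb c x] z assms(1) by (simp add: sum_fun_apply N_def)
    qed
  qed (use that in auto)
  have z0: "v $ (l * N + a) = 0" if "l < r" "a < N" for l a
    using fun_cong[OF z_fun[OF that(1)], of a] that(2)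
    by (simp add: vec_fun_def z_def)
  have "v = 0\<^sub>v (r * N)"
  proof (rule eq_vecI)
    fix q assume "q < dim_vec (0\<^sub>v (r * N))"
    then have q: "q < r * N" by simp
    then have "q div N < r" using less_mult_imp_div_less by simp
    from z0[OF this, of "q mod N"] N show "v $ q = 0\<^sub>v (r * N) $ q" using q by simp
  qed (use v in simp)
  with v(2) show False ..
qed

section \<open>Recovery of a failed node\<close>

text \<open>The rows of \<open>V0\<close> are unit vectors, so the product lists the entries at the
  positions with digit 0, and \<open>a\<close> is one of these.\<close>

lemma V0_mult_eq_imp:
  fixes u v :: "'a::field vec"
  assumes "u \<in> carrier_vec (w ^ nb)" "v \<in> carrier_vec (w ^ nb)"
    and eq: "V0 w nb m *\<^sub>v u = V0 w nb m *\<^sub>v v"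
    and a: "a < w ^ nb" "digit w nb a m = 0"
  shows "u $ a = v $ a"
proof -
  let ?as = "filter (\<lambda>a. digit w nb a m = 0) [0..<w ^ nb]"
  have "a \<in> set ?as" using a by simp
  then obtain p where p: "p < length ?as" "?as ! p = a" by (meson in_set_conv_nth)
  have "(V0 w nb m *\<^sub>v y) $ p = y $ a" if "y \<in> carrier_vec (w ^ nb)" for y :: "'a vec"
    using p a that by (simp add: V0_def)
  then show ?thesis using eq assms by metis
qed

lemma rank_le_dim_row: "mat_rank (A :: 'a::field mat) \<le> dim_row A"
proof -
  interpret vec_space "TYPE('a)" "dim_row A" .
  have A: "A \<in> carrier_mat (dim_row A) (dim_col A)" by simp
  obtain S where S: "maximal S (\<lambda>T. T \<subseteq> set (cols A) \<and> lin_indpt T)"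
    using maximal_exists[of "\<lambda>T. T \<subseteq> set (cols A) \<and> lin_indpt T" "card (set (cols A))" "{}"]
    by (meson List.finite_set card_mono empty_iff empty_subsetI finite_lin_indpt2 rev_finite_subset)
  then have "S \<subseteq> set (cols A) \<and> lin_indpt S" unfolding maximal_def by (rule conjunct1)
  then have "S \<subseteq> carrier_vec (dim_row A)" "lin_indpt S"
    using cols_dim[of A] by (blast, blast)
  then have "card S \<le> dim_row A" by (rule li_le_dim(2)[OF fin_dim, unfolded dim_is_n])
  then show ?thesis unfolding rank_card_indpt[OF A S] .
qed

lemma rank_V0_le:
  "mat_rank (V0 w nb m :: 'a::field mat) \<le> card {a. a < w ^ nb \<and> digit w nb a m = 0}"
proof -
  have "mat_rank (V0 w nb m :: 'a mat) \<le> dim_row (V0 w nb m :: 'a mat)" by (rule rank_le_dim_row)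
  also have "\<dots> = card {a. a < w ^ nb \<and> digit w nb a m = 0}"
    using distinct_card[of "filter (\<lambda>a. digit w nb a m = 0) [0..<w ^ nb]"]
    by (simp add: V0_def conj_commute)
  finally show ?thesis .
qed

text \<open>It suffices that the helper data determine \<open>f i\<close>: the recovery map takes
  node \<open>i\<close> of any codeword with the given data.\<close>

lemma recoverableI:
  assumes "\<And>f g. f \<in> C \<Longrightarrow> g \<in> C \<Longrightarrow> (\<And>j. j \<in> H \<Longrightarrow> R i j *\<^sub>v f j = R i j *\<^sub>v g j) \<Longrightarrow> f i = g i"
  shows "recoverable C R i H"
proof -
  let ?data = "\<lambda>f. \<lambda>j\<in>H. R i j *\<^sub>v f j"
  define \<phi> where "\<phi> y = (SOME g. g \<in> C \<and> ?data g = y) i" for y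
  have "f i = \<phi> (?data f)" if f: "f \<in> C" for f
  proof -
    define g where "g = (SOME g. g \<in> C \<and> ?data g = ?data f)"
    have g: "g \<in> C \<and> ?data g = ?data f"
      unfolding g_def by (rule someI[of _ f]) (simp add: f)
    have "R i j *\<^sub>v f j = R i j *\<^sub>v g j" if "j \<in> H" for j
      using fun_cong[OF conjunct2[OF g], of j] that by simp
    then have "f i = g i" using f g assms by blast
    then show ?thesis by (simp add: \<phi>_def g_def)
  qed
  then show ?thesis unfolding recoverable_def by blast
qed

text \<open>The difference of two codewords with the same helper data satisfies the hypotheses of
  \<open>repair_kernel\<close>.\<close>

lemma recoverable_C3:
  fixes c :: "'a::field"
  assumes w: "2 \<le> w" and nb: "0 < nb" and c: "c \<noteq> 0" and x: "x i \<noteq> 0" and i: "i < n"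
    and inj: "inj_on (node_const w nb c x) {..<n}"
    and H: "H \<subseteq> {..<n} - {i}" "C3_compulsory n nb i \<subseteq> H"
    and r: "w + card ({..<n} - {i} - H) = n - k"
  shows "recoverable (array_code n k (w ^ nb) (C3_parity w nb c x)) (C3_repair w nb) i H"
proof (rule recoverableI)
  fix f g
  let ?C = "array_code n k (w ^ nb) (C3_parity w nb c x)"
  assume f: "f \<in> ?C" and g: "g \<in> ?C"
    and eq: "\<And>j. j \<in> H \<Longrightarrow> C3_repair w nb i j *\<^sub>v f j = C3_repair w nb i j *\<^sub>v g j"
  have carrier: "f j \<in> carrier_vec (w ^ nb)" "g j \<in> carrier_vec (w ^ nb)" if "j < n" for j
    using f g that by (auto simp: array_code_def)
  define F where "F j = vec_fun (w ^ nb) (f j) - vec_fun (w ^ nb) (g j)" for j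
  have "F i = 0"
  proof (rule repair_kernel[where x = x and i = i, OF w nb c x, where I = "{..<n}" and H = H and r = "n - k" and F = F])
    show "{j \<in> {..<n}. j \<noteq> i \<and> j mod nb = i mod nb} \<subseteq> H"
      using H(2) by (auto simp: C3_compulsory_def)
    show "F j \<in> supported (w ^ nb)" for j
      unfolding F_def by (intro supported_diff vec_fun_supported)
    show "(\<Sum>j<n. (node_op w nb c x j ^^ t) (F j)) = 0" if "t < n - k" for t
      using array_code_parity[OF f that] array_code_parity[OF g that] w
      unfolding F_def node_op_pow_diff sum_subtractf by simp
    fix j assume j: "j \<in> H"
    then have jn: "j < n" using H by auto
    show "F j = 0" if "j mod nb = i mod nb"
      using eq[OF j] that carrier[OF jn] by (simp add: C3_repair_def F_def)
    show "zero_digit_part w nb (i mod nb) (F j) = 0" if "j mod nb \<noteq> i mod nb"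
      using V0_mult_eq_imp[OF carrier[OF jn], of "i mod nb"] eq[OF j] that
      by (auto simp: C3_repair_def F_def zero_digit_part_def vec_fun_def fun_eq_iff)
  qed (use i inj H r in auto)
  then have F0: "F i a = 0" for a by simp
  show "f i = g i"
  proof (rule eq_vecI)
    fix a assume "a < dim_vec (g i)"
    then show "f i $ a = g i $ a"
      using F0[of a] carrier[OF i] by (simp add: F_def vec_fun_def)
  qed (use carrier[OF i] in simp)
qed

section \<open>Helper counts and repair bandwidth\<close>

lemma card_residue_class:
  assumes "m < nb"
  shows "card {j. j < s * nb \<and> j mod nb = m} = s"
proof -
  have "{j. j < s * nb \<and> j mod nb = m} = (\<lambda>v. v * nb + m) ` {..<s}"
  proof (rule antisym; rule subsetI)
    fix j assume j: "j \<in> {j. j < s * nb \<and> j mod nb = m}"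
    then have "j = (j div nb) * nb + m" by (metis (mono_tags) div_mult_mod_eq mem_Collect_eq)
    moreover have "j div nb < s" using j by (simp add: less_mult_imp_div_less)
    ultimately show "j \<in> (\<lambda>v. v * nb + m) ` {..<s}" by blast
  next
    fix j assume "j \<in> (\<lambda>v. v * nb + m) ` {..<s}"
    then obtain v where v: "v < s" "j = v * nb + m" by auto
    have "j < Suc v * nb" using v assms by simp
    also have "\<dots> \<le> s * nb" using v by (intro mult_le_mono1) simp
    finally show "j \<in> {j. j < s * nb \<and> j mod nb = m}" using v assms by simp
  qed
  moreover have "inj_on (\<lambda>v. v * nb + m) {..<s}" using assms by (auto simp: inj_on_def)
  ultimately show ?thesis by (simp add: card_image)
qed

lemma card_C3_compulsory:
  assumes "i < s * nb"
  shows "card (C3_compulsory (s * nb) nb i) = s - 1"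
proof -
  have "0 < nb" using assms by (cases nb) auto
  have "C3_compulsory (s * nb) nb i = {j. j < s * nb \<and> j mod nb = i mod nb} - {i}"
    by (auto simp: C3_compulsory_def)
  then show ?thesis using assms \<open>0 < nb\<close> by (simp add: card_residue_class)
qed

text \<open>A compulsory helper contributes rank at most \<open>w ^ nb\<close>, any other at most a
  \<open>w\<close>-th part of that. The factor \<open>w\<close> on the left keeps the bound in the
  natural numbers.\<close>

lemma C3_bandwidth:
  assumes "0 < w" "0 < nb" and H: "finite H" "H \<subseteq> {..<n} - {i}" "C3_compulsory n nb i \<subseteq> H"
  shows "w * (\<Sum>j\<in>H. mat_rank (C3_repair w nb i j :: 'a::field mat)) \<le>
    (card (C3_compulsory n nb i) * (w - 1) + card H) * w ^ nb"
proof -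
  let ?R = "\<lambda>j. mat_rank (C3_repair w nb i j :: 'a mat)"
  let ?D = "C3_compulsory n nb i"
  have D: "w * ?R j \<le> w * w ^ nb" if "j \<in> ?D" for j
    using that rank_le_dim_row[of "C3_repair w nb i j :: 'a mat"]
    by (simp add: C3_compulsory_def C3_repair_def)
  have other: "w * ?R j \<le> w ^ nb" if "j \<in> H - ?D" for j
  proof -
    have "j mod nb \<noteq> i mod nb" using that H by (auto simp: C3_compulsory_def)
    then have "w * ?R j = w * mat_rank (V0 w nb (i mod nb) :: 'a mat)"
      by (simp add: C3_repair_def)
    also have "\<dots> \<le> w * card {a. a < w ^ nb \<and> digit w nb a (i mod nb) = 0}"
      by (rule mult_le_mono2[OF rank_V0_le])
    also have "\<dots> \<le> w ^ nb"
      using card_digit_zero[of w "i mod nb" nb] assms by (simp add: mult.commute)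
    finally show ?thesis .
  qed
  have "w * (\<Sum>j\<in>H. ?R j) = (\<Sum>j\<in>?D. w * ?R j) + (\<Sum>j\<in>H - ?D. w * ?R j)"
    using H by (simp add: sum_distrib_left sum.subset_diff[of ?D H] add_mult_distrib2)
  also have "\<dots> \<le> card ?D * (w * w ^ nb) + card (H - ?D) * w ^ nb"
    using sum_bounded_above[of ?D, OF D] sum_bounded_above[of "H - ?D", OF other]
    by (intro add_mono) simp_all
  also have "\<dots> = (card ?D * (w - 1) + card H) * w ^ nb"
  proof -
    have "card (H - ?D) + card ?D = card H"
      using H by (metis card_Diff_subset card_mono finite_subset le_add_diff_inverse2)
    moreover obtain v where "w = Suc v" using assms(1) by (cases w) auto
    ultimately show ?thesis by (simp add: algebra_simps flip: \<open>card (H - ?D) + card ?D = card H\<close>)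
  qed
  finally show ?thesis .
qed

section \<open>From the conditions on \<open>x\<close> and \<open>c\<close> to the theorem\<close>

theorem theorem8:
  fixes c :: "'a::{field,finite}" and x :: "nat \<Rightarrow> 'a"
    and s w r nb kb db N n k d dc :: nat
  assumes "s \<ge> 2" and "2 \<le> w" and "w < r" and "r < nb"
    and "kb = nb - r" and "db = kb + w - 1" and "N = w ^ nb" and "n = s * nb" and "k = n - r"
    and "d = n - nb + db" and "dc = s - 1"
    and "primitive_element c" and "CARD('a) > nb"
    and "\<forall>i<n. x i \<noteq> 0"
    and "\<forall>u<s. \<forall>i<nb.
      (\<forall>v0<s. \<forall>v1<s. \<forall>j0<nb - 1. \<forall>j1<nb - 1. (v0, j0) \<noteq> (v1, j1) \<longrightarrow>
         (j0 \<in> {0..<i} \<and> j1 \<in> {0..<i} \<longrightarrow>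
            x (v0 * nb + j0) ^ w * c ^ j0 \<noteq> x (v1 * nb + j1) ^ w * c ^ j1) \<and>
         (j0 \<in> {i..<nb - 1} \<and> j1 \<in> {i..<nb - 1} \<longrightarrow>
            x (v0 * nb + j0 + 1) ^ w * c ^ j0 \<noteq> x (v1 * nb + j1 + 1) ^ w * c ^ j1) \<and>
         (j0 \<in> {0..<i} \<and> j1 \<in> {i..<nb - 1} \<longrightarrow>
            x (v0 * nb + j0) ^ w * c ^ j0 \<noteq> x (v1 * nb + j1 + 1) ^ w * c ^ (j1 + 1))) \<and>
      (\<forall>v<s.
         (\<forall>j\<in>{0..<i}. x (v * nb + j) ^ w * c ^ j - x (u * nb + i) ^ w * c ^ i \<noteq> 0) \<and>
         (\<forall>j\<in>{i..<nb - 1}.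
            x (v * nb + j + 1) ^ w * c ^ (j + 1) - x (u * nb + i) ^ w * c ^ i \<noteq> 0))"
  shows "is_MDS n k N (C3_parity w nb c x) \<and>
    repair_property n k N (C3_parity w nb c x) (C3_repair w nb) (C3_compulsory n nb) d dc
      (real dc * (real d - real k) / real d)"
proof -
  have "nb \<le> n" using assms(1,8) by simp
  \<comment> \<open>\<open>nb \<le> n\<close> and \<open>r < nb\<close> guard the truncated
    subtractions; the result is \<open>d - k + 1 = w\<close>.\<close>
  then have d: "d = k + (w - 1)" and k: "n - k = r" "k \<le> n" using assms(2-6,9,10) by auto
  have "c ^ 1 \<in> range (\<lambda>m. c ^ m)" by (rule rangeI)
  then have c: "c \<noteq> 0" using assms(12) by (simp add: primitive_element_def)
  note cond = assms(15)[THEN spec, THEN mp, THEN spec, THEN mp]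
  \<comment> \<open>Condition ii), first case, with the node of larger residue in the role of the
    pair \<open>(u, i)\<close> of the hypothesis.\<close>
  have below: "x i ^ w * c ^ (i mod nb) \<noteq> x j ^ w * c ^ (j mod nb)"
    if "i < n" "j < n" "i mod nb < j mod nb" for i j
  proof -
    have "i div nb < s" "j div nb < s" using that assms(8) by (simp_all add: less_mult_imp_div_less)
    moreover have "j mod nb < nb" using assms(4) by simp
    ultimately have "x (i div nb * nb + i mod nb) ^ w * c ^ (i mod nb) -
        x (j div nb * nb + j mod nb) ^ w * c ^ (j mod nb) \<noteq> 0"
      using cond[of "j div nb" "j mod nb", THEN conjunct2, THEN spec, THEN mp, of "i div nb",
          THEN conjunct1, THEN bspec, of "i mod nb"] that(3) by simp
    then show ?thesis by simp
  qed
  have same: "x i ^ w \<noteq> x j ^ w"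
    if ij: "i < n" "j < n" "i mod nb = j mod nb" "i \<noteq> j" for i j
  proof -
    define m where "m = i mod nb"
    have div: "i div nb < s" "j div nb < s" using ij assms(8) by (simp_all add: less_mult_imp_div_less)
    have ne: "i div nb \<noteq> j div nb" using ij(3,4) by (metis div_mult_mod_eq)
    have i: "i = i div nb * nb + m" and j: "j = j div nb * nb + m"
      using ij(3) div_mult_mod_eq[of i nb] div_mult_mod_eq[of j nb] by (simp_all add: m_def)
    have m: "m < nb" using assms(4) by (simp add: m_def)
    show ?thesis
    proof (cases "m < nb - 1")
      case True
      \<comment> \<open>Condition i) with \<open>nb - 1\<close> for its index \<open>i\<close>:
        \<open>j0 = j1 = m\<close> lies below it.\<close>
      have "x (i div nb * nb + m) ^ w * c ^ m \<noteq> x (j div nb * nb + m) ^ w * c ^ m"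
        using cond[of 0 "nb - 1", THEN conjunct1, THEN spec, THEN mp, of "i div nb",
            THEN spec, THEN mp, of "j div nb", THEN spec, THEN mp, of m, THEN spec, THEN mp, of m,
            THEN mp, THEN conjunct1, THEN mp]
          assms(1,4) div ne True by simp
      then show ?thesis using i j by auto
    next
      case False
      \<comment> \<open>The unshifted indices of condition i) stop before the residue
        \<open>nb - 1\<close>. With 0 for its index \<open>i\<close> all indices are shifted by one,
        so \<open>nb - 2\<close> stands for this residue.\<close>
      then have m': "m = nb - 2 + 1" "nb - 2 < nb - 1" using m assms(2-4) by auto
      have "x (i div nb * nb + (nb - 2) + 1) ^ w * c ^ (nb - 2) \<noteq>
          x (j div nb * nb + (nb - 2) + 1) ^ w * c ^ (nb - 2)"
        using cond[of 0 0, THEN conjunct1, THEN spec, THEN mp, of "i div nb",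
            THEN spec, THEN mp, of "j div nb", THEN spec, THEN mp, of "nb - 2",
            THEN spec, THEN mp, of "nb - 2", THEN mp, THEN conjunct2, THEN conjunct1, THEN mp]
          assms(1,4) div ne m'(2) by simp
      then show ?thesis using i j unfolding m' by (metis add.assoc)
    qed
  qed
  have inj: "inj_on (node_const w nb c x) {..<n}"
  proof (rule inj_onI, rule ccontr)
    fix i j assume *: "i \<in> {..<n}" "j \<in> {..<n}" "node_const w nb c x i = node_const w nb c x j" "i \<noteq> j"
    then have eq: "x i ^ w * c ^ (i mod nb) = x j ^ w * c ^ (j mod nb)"
      using c by (simp add: node_const_def)
    consider "i mod nb < j mod nb" | "j mod nb < i mod nb" | "i mod nb = j mod nb" by linarith
    then show False
      using below[of i j] below[of j i] same[of i j] * eq c by cases auto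
  qed
  have "is_MDS n k N (C3_parity w nb c x)"
    unfolding assms(7) by (rule is_MDS_C3[OF _ _ inj]) (use assms in auto)
  moreover have "repair_property n k N (C3_parity w nb c x) (C3_repair w nb) (C3_compulsory n nb) d dc
      (real dc * (real d - real k) / real d)"
    unfolding repair_property_def
  proof (intro allI impI conjI; (elim conjE)?)
    fix i assume i: "i < n"
    show "C3_compulsory n nb i \<subseteq> {..<n} - {i}" by (auto simp: C3_compulsory_def)
    show card: "card (C3_compulsory n nb i) = dc"
      using card_C3_compulsory i assms(8,11) by simp
    fix H assume H: "H \<subseteq> {..<n} - {i}" "card H = d" "C3_compulsory n nb i \<subseteq> H"
    have fin: "finite H" using H(1) finite_subset by blast
    have "card ({..<n} - {i} - H) = n - 1 - d"
      using card_Diff_subset[OF fin H(1)] H(2) i by simp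
    \<comment> \<open>\<open>n - 1 - d = r - w\<close>: the \<open>w\<close> slices of node
      \<open>i\<close> and the nodes that do not help together use up all \<open>n - k\<close>
      parity equations.\<close>
    then have "w + card ({..<n} - {i} - H) = n - k"
      using d k assms(2,3) by auto
    then show "recoverable (array_code n k N (C3_parity w nb c x)) (C3_repair w nb) i H"
      unfolding assms(7)
      using recoverable_C3[OF assms(2) _ c _ i inj H(1,3)] assms(4,14) i by simp
    define \<gamma> where "\<gamma> = (\<Sum>j\<in>H. mat_rank (C3_repair w nb i j :: 'a mat))"
    have "w * \<gamma> \<le> (dc * (w - 1) + d) * N"
      using C3_bandwidth[of w nb H n i, where 'a = 'a] assms(2,4) fin H card
      by (simp add: assms(7) \<gamma>_def)
    then have "real (w * \<gamma>) \<le> real ((dc * (w - 1) + d) * N)"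
      by (rule of_nat_mono)
    then have "real \<gamma> * real w \<le> (real dc * (real w - 1) + real d) * real N"
      using assms(2) by (simp add: of_nat_diff mult.commute)
    then have "real \<gamma> \<le> (real dc * (real w - 1) + real d) * real N / real w"
      using assms(2) by (simp add: pos_le_divide_eq)
    \<comment> \<open>\<open>d / w\<close> is the optimal bandwidth in units of \<open>N\<close>;
      \<open>w - 1 = d - k\<close> then gives the claimed excess.\<close>
    also have "\<dots> = (1 + real dc * (real w - 1) / real d) * (real d / real w) * real N"
    proof -
      have "real d \<noteq> 0" using d assms(2) by simp
      then have "1 + real dc * (real w - 1) / real d = (real dc * (real w - 1) + real d) / real d"
        by (simp add: add_divide_distrib)
      then show ?thesis using \<open>real d \<noteq> 0\<close> by simp
    qed
    also have "\<dots> = (1 + real dc * (real d - real k) / real d) *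
        (real d / (real d - real k + 1)) * real N"
    proof -
      have "real w = real d - real k + 1" using d assms(2) by (simp add: of_nat_diff)
      then show ?thesis by simp
    qed
    finally show "real (\<Sum>j\<in>H. mat_rank (C3_repair w nb i j :: 'a mat)) \<le>
        (1 + real dc * (real d - real k) / real d) * (real d / (real d - real k + 1)) * real N"
      unfolding \<gamma>_def .
  qed
  ultimately show ?thesis ..
qed

end
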